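(* Assume $MA_{\omega_1}$. Let $\chi=(\omega_1,c)$ be a rectangular model in a language consisting of finitely many symmetric binary relation symbols. Then $\omega_1$ is a union of countably many monochromatic sets.
   Context: Here $c(x,y)$ is the quantifier-free type of the pair $(x,y)$ in $\chi$; it takes finitely many values and is symmetric. A set $A\subseteq\omega_1$ is monochromatic if $c$ is constant on $\{(a,b)\in A\times A: a\neq b\}$. Tuples $\bar x,\bar y\in\omega_1^n$ with disjoint entry sets are alike if: $c(x_i,y_i)=c(x_j,y_j)$ and $c(y_i,x_i)=c(y_j,x_j)$ for all $i,j$; $c(x_i,x_j)=c(y_i,y_j)$ for all $i,j$; and for all $i,j$ with $x_i\neq x_j$, $c(x_i,x_j)=c(x_i,y_j)=c(y_i,x_j)$. $\chi$ is rectangular if for every $n$ and every family of $\omega_1$ many $n$-tuples with pairwise disjoint entry sets, two distinct members are alike. *)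

theory Defs
  imports Main "HOL-Library.Countable_Set" "HOL-Library.Equipollence"
begin

text \<open>The cardinal successor of \<open>natLeq\<close> is a well-order on a set of sets of naturals; its field
  serves as the set of countable ordinals.\<close>

definition omega1 :: "nat set set" where
  "omega1 = Field (cardSuc natLeq)"

text \<open>A forcing notion is a set \<open>P\<close> with a partial order \<open>le\<close> on it, where \<open>(p, q) \<in> le\<close> means that
  \<open>p\<close> is below (stronger than) \<open>q\<close>.\<close>

definition compatible :: "'p set \<Rightarrow> 'p rel \<Rightarrow> 'p \<Rightarrow> 'p \<Rightarrow> bool" where
  "compatible P le p q \<longleftrightarrow> (\<exists>r\<in>P. (r, p) \<in> le \<and> (r, q) \<in> le)"

definition antichain :: "'p set \<Rightarrow> 'p rel \<Rightarrow> 'p set \<Rightarrow> bool" where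
  "antichain P le A \<longleftrightarrow>
     A \<subseteq> P \<and> (\<forall>p\<in>A. \<forall>q\<in>A. p \<noteq> q \<longrightarrow> \<not> compatible P le p q)"

definition ccc :: "'p set \<Rightarrow> 'p rel \<Rightarrow> bool" where
  "ccc P le \<longleftrightarrow> (\<forall>A. antichain P le A \<longrightarrow> countable A)"

definition dense_in :: "'p set \<Rightarrow> 'p rel \<Rightarrow> 'p set \<Rightarrow> bool" where
  "dense_in P le D \<longleftrightarrow> D \<subseteq> P \<and> (\<forall>p\<in>P. \<exists>d\<in>D. (d, p) \<in> le)"

definition poset_filter :: "'p set \<Rightarrow> 'p rel \<Rightarrow> 'p set \<Rightarrow> bool" where
  "poset_filter P le G \<longleftrightarrow>
     G \<subseteq> P \<and> G \<noteq> {} \<and>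
     (\<forall>p\<in>G. \<forall>q\<in>P. (p, q) \<in> le \<longrightarrow> q \<in> G) \<and>
     (\<forall>p\<in>G. \<forall>q\<in>G. \<exists>r\<in>G. (r, p) \<in> le \<and> (r, q) \<in> le)"

text \<open>HOL cannot quantify over types inside a formula, so Martin's axiom is stated for all posets
  whose conditions are drawn from a given type. It expresses Martin's axiom
  only over types with at least \<open>omega1\<close> many elements; over a finite type, say, it holds trivially.\<close>

definition MA_omega1 :: "'p itself \<Rightarrow> bool" where
  "MA_omega1 _ \<longleftrightarrow>
     (\<forall>(P :: 'p set) le \<D>.
        P \<noteq> {} \<and> partial_order_on P le \<and> ccc P le \<and>
        \<D> \<lesssim> omega1 \<and> (\<forall>D\<in>\<D>. dense_in P le D) \<longrightarrow>
        (\<exists>G. poset_filter P le G \<and> (\<forall>D\<in>\<D>. G \<inter> D \<noteq> {})))"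

datatype var = VX | VY

datatype (symbols: 'l) qf_formula =
    Eq var var
  | Rel 'l var var
  | Neg "'l qf_formula"
  | Conj "'l qf_formula" "'l qf_formula"

primrec var_val :: "'a \<Rightarrow> 'a \<Rightarrow> var \<Rightarrow> 'a" where
  "var_val x y VX = x"
| "var_val x y VY = y"

primrec qf_sat :: "('l \<Rightarrow> 'a \<Rightarrow> 'a \<Rightarrow> bool) \<Rightarrow> 'a \<Rightarrow> 'a \<Rightarrow> 'l qf_formula \<Rightarrow> bool" where
  "qf_sat R x y (Eq u v) \<longleftrightarrow> var_val x y u = var_val x y v"
| "qf_sat R x y (Rel l u v) \<longleftrightarrow> R l (var_val x y u) (var_val x y v)"
| "qf_sat R x y (Neg \<phi>) \<longleftrightarrow> \<not> qf_sat R x y \<phi>"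
| "qf_sat R x y (Conj \<phi> \<psi>) \<longleftrightarrow> qf_sat R x y \<phi> \<and> qf_sat R x y \<psi>"

definition qf_type ::
    "'l set \<Rightarrow> ('l \<Rightarrow> 'a \<Rightarrow> 'a \<Rightarrow> bool) \<Rightarrow> 'a \<Rightarrow> 'a \<Rightarrow> 'l qf_formula set" where
  "qf_type L R x y = {\<phi>. symbols \<phi> \<subseteq> L \<and> qf_sat R x y \<phi>}"

definition monochromatic :: "(nat set \<Rightarrow> nat set \<Rightarrow> 'c) \<Rightarrow> nat set set \<Rightarrow> bool" where
  "monochromatic c A \<longleftrightarrow>
     A \<subseteq> omega1 \<and> (\<exists>k. \<forall>a\<in>A. \<forall>b\<in>A. a \<noteq> b \<longrightarrow> c a b = k)"

text \<open>An \<open>n\<close>-tuple is a list of length \<open>n\<close>; repeated entries are allowed.\<close>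

definition alike :: "('a \<Rightarrow> 'a \<Rightarrow> 'c) \<Rightarrow> nat \<Rightarrow> 'a list \<Rightarrow> 'a list \<Rightarrow> bool" where
  "alike c n x y \<longleftrightarrow>
     length x = n \<and> length y = n \<and> set x \<inter> set y = {} \<and>
     (\<forall>i<n. \<forall>j<n. c (x ! i) (y ! i) = c (x ! j) (y ! j) \<and> c (y ! i) (x ! i) = c (y ! j) (x ! j)) \<and>
     (\<forall>i<n. \<forall>j<n. c (x ! i) (x ! j) = c (y ! i) (y ! j)) \<and>
     (\<forall>i<n. \<forall>j<n. x ! i \<noteq> x ! j \<longrightarrow>
        c (x ! i) (x ! j) = c (x ! i) (y ! j) \<and> c (x ! i) (y ! j) = c (y ! i) (x ! j))"

definition rectangular :: "(nat set \<Rightarrow> nat set \<Rightarrow> 'c) \<Rightarrow> bool" where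
  "rectangular c \<longleftrightarrow>
     (\<forall>n \<F>.
        (\<forall>x\<in>\<F>. length x = n \<and> set x \<subseteq> omega1) \<and>
        \<F> \<approx> omega1 \<and>
        (\<forall>x\<in>\<F>. \<forall>y\<in>\<F>. x \<noteq> y \<longrightarrow> set x \<inter> set y = {}) \<longrightarrow>
        (\<exists>x\<in>\<F>. \<exists>y\<in>\<F>. x \<noteq> y \<and> alike c n x y))"

end

theory Submission
  imports Defs "HOL-Library.Countable_Set_Type" "HOL-Library.Disjoint_Sets"
    "HOL-Algebra.Free_Abelian_Groups"
begin

text \<open>For a colour \<open>k\<close> let \<open>P\<^sub>k\<close> be the poset of finite approximations to a cover of \<open>\<omega>\<^sub>1\<close> by countably
  many \<open>k\<close>-homogeneous classes. If some \<open>P\<^sub>k\<close> is ccc, Martin's axiom yields such a cover. Otherwise,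
  for each of the finitely many colours \<open>k\<close>, thinning out an uncountable antichain of \<open>P\<^sub>k\<close> to a
  \<open>\<Delta>\<close>-system gives uncountably many disjoint tuples such that no two of them are alike with
  diagonal colour \<open>k\<close>: two such conditions would be compatible. Concatenate these tuples over all \<open>k\<close>.
  By rectangularity two of the concatenations are alike; if \<open>d\<close> is their common diagonal colour, then
  their blocks for \<open>d\<close> are alike with diagonal colour \<open>d\<close>, a contradiction.\<close>

section \<open>Uncountable sets\<close>

lemma uncountable_omega1: "uncountable omega1"
proof
  assume "countable omega1"
  then have "|omega1| \<le>o natLeq"
    by (simp add: countable_card_le_natLeq)
  moreover have "natLeq <o cardSuc natLeq"
    by (rule cardSuc_greater[OF natLeq_Card_order])
  moreover have "|omega1| =o cardSuc natLeq"
    unfolding omega1_def by (rule card_of_Field_ordIso[OF cardSuc_Card_order[OF natLeq_Card_order]])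
  ultimately show False
    using not_ordLess_ordLeq ordIso_ordLeq_trans ordIso_symmetric by blast
qed

text \<open>\<open>omega1\<close> has the successor cardinality of \<open>natLeq\<close>, hence the
  least uncountable one. The lemma serves to index members of an uncountable set injectively by
  \<open>omega1\<close>.\<close>

lemma omega1_lepoll_iff: "omega1 \<lesssim> A \<longleftrightarrow> uncountable A"
proof
  assume "omega1 \<lesssim> A"
  then show "uncountable A"
    using countable_lepoll uncountable_omega1 by blast
next
  assume "uncountable A"
  then have "natLeq <o |A|"
    by (simp add: countable_card_le_natLeq natLeq_Well_order)
  then have "cardSuc natLeq \<le>o |A|"
    by (simp add: cardSuc_ordLess_ordLeq[OF natLeq_Card_order card_of_Card_order])
  moreover have "|omega1| =o cardSuc natLeq"
    unfolding omega1_def by (rule card_of_Field_ordIso[OF cardSuc_Card_order[OF natLeq_Card_order]])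
  ultimately have "|omega1| \<le>o |A|"
    by (rule ordIso_ordLeq_trans[rotated])
  then show "omega1 \<lesssim> A"
    by (simp add: lepoll_def card_of_ordLeq[symmetric])
qed

lemma uncountable_subset_eqpoll_omega1:
  assumes "uncountable A"
  obtains B where "B \<subseteq> A" "B \<approx> omega1"
proof -
  from assms obtain f where "inj_on f omega1" "f ` omega1 \<subseteq> A"
    by (auto simp: omega1_lepoll_iff[symmetric] lepoll_def)
  then show thesis
    using that inj_on_image_eqpoll_self by blast
qed

lemma uncountable_fibre:
  assumes "uncountable A" "countable (f ` A)"
  obtains y where "uncountable {a \<in> A. f a = y}"
proof (rule ccontr)
  assume "\<not> thesis"
  then have "countable (\<Union>y \<in> f ` A. {a \<in> A. f a = y})"
    using assms(2) that by blast
  moreover have "A = (\<Union>y \<in> f ` A. {a \<in> A. f a = y})"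
    by blast
  ultimately show False
    using assms(1) by argo
qed

text \<open>Take a maximal disjoint subfamily \<open>M\<close>, by Zorn's lemma. If \<open>M\<close>
  were countable, the union of its sets would be countable; by maximality every other index has a
  set meeting that union, and by \<open>pt\<close> each point accounts for only countably many
  indices, so \<open>I\<close> would be countable.\<close>

lemma uncountable_disjoint_subfamily:
  fixes S :: "'i \<Rightarrow> 'a set"
  assumes I: "uncountable I"
    and S: "\<And>i. i \<in> I \<Longrightarrow> countable (S i)"
    and pt: "\<And>a. countable {i \<in> I. a \<in> S i}"
  obtains J where "J \<subseteq> I" "uncountable J" "disjoint_family_on S J"
proof -
  let ?\<A> = "{J. J \<subseteq> I \<and> disjoint_family_on S J}"
  have "\<exists>M\<in>?\<A>. \<forall>X\<in>?\<A>. M \<subseteq> X \<longrightarrow> X = M"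
  proof (rule subset_Zorn')
    fix C assume C: "subset.chain ?\<A> C"
    have "S i \<inter> S j = {}" if ij: "i \<in> \<Union>C" "j \<in> \<Union>C" "i \<noteq> j" for i j
    proof -
      from ij obtain X Y where "X \<in> C" "Y \<in> C" "i \<in> X" "j \<in> Y"
        by blast
      moreover from this C have "X \<subseteq> Y \<or> Y \<subseteq> X"
        by (auto simp: subset_chain_def)
      ultimately obtain Z where "Z \<in> C" "i \<in> Z" "j \<in> Z"
        by blast
      moreover from this C have "disjoint_family_on S Z"
        by (auto simp: subset_chain_def)
      ultimately show ?thesis
        using \<open>i \<noteq> j\<close> by (auto dest: disjoint_family_onD)
    qed
    then show "\<Union>C \<in> ?\<A>"
      using C by (auto simp: subset_chain_def disjoint_family_on_def)
  qed
  then obtain M where "M \<in> ?\<A>" and M_max: "\<forall>X\<in>?\<A>. M \<subseteq> X \<longrightarrow> X = M"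
    by (rule bexE)
  then have M: "M \<subseteq> I" "disjoint_family_on S M"
    by simp_all
  have max: "X = M" if "X \<subseteq> I" "disjoint_family_on S X" "M \<subseteq> X" for X
    using M_max that by simp
  have "uncountable M"
  proof
    assume cM: "countable M"
    have "i \<in> M \<union> (\<Union>a\<in>(\<Union>j\<in>M. S j). {i \<in> I. a \<in> S i})" if "i \<in> I" for i
    proof (rule ccontr)
      assume i: "i \<notin> M \<union> (\<Union>a\<in>(\<Union>j\<in>M. S j). {i \<in> I. a \<in> S i})"
      then have "disjoint_family_on S (insert i M)"
        using M(2) \<open>i \<in> I\<close> by (fastforce simp: disjoint_family_on_def)
      then have "insert i M = M"
        using max M(1) \<open>i \<in> I\<close> by blast
      then show False
        using i by blast
    qed
    then have "I \<subseteq> M \<union> (\<Union>a\<in>(\<Union>j\<in>M. S j). {i \<in> I. a \<in> S i})"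
      by blast
    moreover have "countable \<dots>"
      using cM M(1) S pt by (intro countable_Un countable_UN) auto
    ultimately show False
      using I countable_subset by blast
  qed
  with M that show thesis
    by blast
qed

text \<open>A \<open>\<Delta>\<close>-system lemma. The root \<open>R\<close> is a set of maximal size contained in uncountably many of the
  domains, so that every point outside of \<open>R\<close> lies in only countably many of these domains.\<close>

lemma delta_system_of_finite_relations:
  fixes A :: "('a \<times> nat) set set"
  assumes A: "uncountable A" "\<And>p. p \<in> A \<Longrightarrow> finite p"
  obtains B R m x where
    "B \<subseteq> A" "uncountable B" "m > 0"
    "\<And>p. p \<in> B \<Longrightarrow> length (x p) = m \<and> distinct (x p) \<and> set (x p) = fst ` p - R"
    "disjoint_family_on (\<lambda>p. set (x p)) B"
    "\<And>p q a n. p \<in> B \<Longrightarrow> q \<in> B \<Longrightarrow> a \<in> R \<Longrightarrow> (a, n) \<in> p \<longleftrightarrow> (a, n) \<in> q"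
    "\<And>p q i n. p \<in> B \<Longrightarrow> q \<in> B \<Longrightarrow> i < m \<Longrightarrow> (x p ! i, n) \<in> p \<longleftrightarrow> (x q ! i, n) \<in> q"
proof -
  \<comment> \<open>A common domain size \<open>N\<close> bounds the size of every possible root, so
    that a largest one exists.\<close>
  obtain N where N: "uncountable {p \<in> A. card (fst ` p) = N}"
    using uncountable_fibre[OF A(1), of "\<lambda>p. card (fst ` p)"] countableI_type by metis
  define A1 where "A1 = {p \<in> A. card (fst ` p) = N}"
  define above where "above R = {p \<in> A1. R \<subseteq> fst ` p}" for R
  define Q where "Q R \<longleftrightarrow> finite R \<and> uncountable (above R)" for R
  have "Q {}"
    using N by (simp add: A1_def Q_def above_def)
  moreover have "\<forall>R. Q R \<longrightarrow> card R \<le> N"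
  proof (intro allI impI)
    fix R assume "Q R"
    then obtain p where "p \<in> above R"
      unfolding Q_def by (metis countable_empty ex_in_conv)
    then have "p \<in> A1" "R \<subseteq> fst ` p"
      by (auto simp: above_def)
    then show "card R \<le> N"
      using A(2) card_mono[of "fst ` p" R] by (simp add: A1_def)
  qed
  ultimately obtain R where QR: "Q R" and Rmax: "\<And>R'. Q R' \<Longrightarrow> card R' \<le> card R"
    using ex_has_greatest_nat[of Q "{}" card "Suc N"] by (auto simp: less_Suc_eq_le)
  define A2 where "A2 = above R"
  have R: "finite R" and A2: "uncountable A2" "A2 \<subseteq> A"
    using QR by (auto simp: Q_def A2_def above_def A1_def)
  have "countable {p \<in> A2. a \<in> fst ` p - R}" for a
  proof (cases "a \<in> R")
    case False
    have "\<not> Q (insert a R)"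
      using Rmax[of "insert a R"] False R by auto
    then have "countable (above (insert a R))"
      using R by (simp add: Q_def)
    then show ?thesis
      by (rule countable_subset[rotated]) (auto simp: A2_def above_def)
  qed simp
  then obtain A3 where A3: "A3 \<subseteq> A2" "uncountable A3" "disjoint_family_on (\<lambda>p. fst ` p - R) A3"
    using uncountable_disjoint_subfamily[OF A2(1), of "\<lambda>p. fst ` p - R"] A2(2) A(2)
    by (metis (no_types, lifting) countable_finite finite_Diff finite_imageI subsetD)
  have "\<forall>p\<in>A3. \<exists>xs. distinct xs \<and> set xs = fst ` p - R"
    using A3(1) A2(2) A(2) finite_distinct_list by (metis finite_Diff finite_imageI subsetD)
  then obtain x where x: "\<And>p. p \<in> A3 \<Longrightarrow> distinct (x p) \<and> set (x p) = fst ` p - R"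
    by metis
  \<comment> \<open>The pattern is everything about \<open>p\<close> except which points form its
    petal: the petal's size, the part of \<open>p\<close> over the root, and the classes of the
    \<open>i\<close>-th petal point. Only countably many patterns exist, so uncountably many
    conditions share one.\<close>
  define pat where "pat p = (length (x p), {(a, n). a \<in> R \<and> (a, n) \<in> p},
      {(i, n). i < length (x p) \<and> (x p ! i, n) \<in> p})" for p
  have "pat ` A3 \<subseteq> UNIV \<times> Fpow (R \<times> UNIV) \<times> Fpow UNIV"
  proof (rule image_subsetI)
    fix p assume "p \<in> A3"
    then have fin: "finite p"
      using A3(1) A2(2) A(2) by blast
    have "finite {(a, n). a \<in> R \<and> (a, n) \<in> p}"
      by (rule finite_subset[OF _ fin]) auto
    moreover have "finite {(i, n). i < length (x p) \<and> (x p ! i, n) \<in> p}"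
      by (rule finite_subset[of _ "{..<length (x p)} \<times> snd ` p"]) (use fin in \<open>auto simp: image_iff Bex_def\<close>)
    ultimately show "pat p \<in> UNIV \<times> Fpow (R \<times> UNIV) \<times> Fpow UNIV"
      by (auto simp: pat_def Fpow_def)
  qed
  moreover have "countable (UNIV \<times> Fpow (R \<times> UNIV) \<times> Fpow UNIV :: (nat \<times> ('a \<times> nat) set \<times> (nat \<times> nat) set) set)"
    using R by (intro countable_SIGMA countable_Fpow) (auto intro: countable_finite)
  ultimately have "countable (pat ` A3)"
    by (rule countable_subset)
  then obtain y where y: "uncountable {p \<in> A3. pat p = y}"
    using uncountable_fibre[OF A3(2)] by blast
  define B where "B = {p \<in> A3. pat p = y}"
  have unB: "uncountable B"
    using y by (simp add: B_def)
  have len: "length (x p) = fst y" if "p \<in> B" for p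
    using that by (auto simp: B_def pat_def)
  have root: "(a, n) \<in> p \<longleftrightarrow> (a, n) \<in> q" if "p \<in> B" "q \<in> B" "a \<in> R" for p q a n
  proof -
    have "{(a, n). a \<in> R \<and> (a, n) \<in> p} = {(a, n). a \<in> R \<and> (a, n) \<in> q}"
      using that by (auto simp: B_def pat_def)
    then show ?thesis
      using that(3) by (auto simp: set_eq_iff)
  qed
  have petal: "(x p ! i, n) \<in> p \<longleftrightarrow> (x q ! i, n) \<in> q" if "p \<in> B" "q \<in> B" "i < fst y" for p q i n
  proof -
    have "{(i, n). i < length (x p) \<and> (x p ! i, n) \<in> p} = {(i, n). i < length (x q) \<and> (x q ! i, n) \<in> q}"
      using that by (auto simp: B_def pat_def)
    then show ?thesis
      using that len by (auto simp: set_eq_iff)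
  qed
  \<comment> \<open>With empty petals, every member of \<open>B\<close> would be a finite subset of
    the countable set of pairs over the finite root, leaving only countably many members.\<close>
  have "fst y \<noteq> 0"
  proof
    assume "fst y = 0"
    then have "fst ` p - R = {}" if "p \<in> B" for p
      using len x that by (force simp: B_def)
    moreover have "finite p" if "p \<in> B" for p
      using that A3(1) A2(2) A(2) by (auto simp: B_def)
    ultimately have "B \<subseteq> Fpow (R \<times> UNIV)"
      by (force simp: Fpow_def)
    moreover have "countable (Fpow (R \<times> (UNIV :: nat set)))"
      using R by (intro countable_SIGMA countable_Fpow) (auto intro: countable_finite)
    ultimately show False
      using unB countable_subset by blast
  qed
  show thesis
  proof
    show "B \<subseteq> A"
      using A3(1) A2(2) by (auto simp: B_def)
    show "disjoint_family_on (\<lambda>p. set (x p)) B"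
      using A3(3) x by (auto simp: B_def disjoint_family_on_def)
    show "length (x p) = fst y \<and> distinct (x p) \<and> set (x p) = fst ` p - R" if "p \<in> B" for p
      using that len x by (auto simp: B_def)
    show "0 < fst y"
      using \<open>fst y \<noteq> 0\<close> by simp
  qed (fact unB root petal)+
qed

section \<open>Martin's axiom\<close>

lemma MA_omega1_lepoll:
  fixes P :: "'q set" and le :: "'q rel"
  assumes MA: "MA_omega1 TYPE('p)" and card: "P \<lesssim> (UNIV :: 'p set)"
    and P: "P \<noteq> {}" "partial_order_on P le" "ccc P le"
    and \<D>: "\<D> \<lesssim> omega1" "\<And>D. D \<in> \<D> \<Longrightarrow> dense_in P le D"
  obtains G where "poset_filter P le G" "\<And>D. D \<in> \<D> \<Longrightarrow> G \<inter> D \<noteq> {}"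
proof -
  obtain f :: "'q \<Rightarrow> 'p" where f: "inj_on f P"
    using card by (auto simp: lepoll_def)
  define le' where "le' = map_prod f f ` le"
  note po = partial_order_onD[OF P(2)]
  have f_eq: "f p = f q \<longleftrightarrow> p = q" if "p \<in> P" "q \<in> P" for p q
    using f that by (auto simp: inj_on_def)
  have le'_iff: "(f p, f q) \<in> le' \<longleftrightarrow> (p, q) \<in> le" if "p \<in> P" "q \<in> P" for p q
  proof
    assume "(f p, f q) \<in> le'"
    then obtain p' q' where pq': "(p', q') \<in> le" "f p = f p'" "f q = f q'"
      by (auto simp: le'_def)
    then have "p' \<in> P" "q' \<in> P"
      using po(4) by blast+
    then show "(p, q) \<in> le"
      using pq' that f_eq by metis
  qed (force simp: le'_def)
  have le'_sub: "le' \<subseteq> f ` P \<times> f ` P"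
    using po(4) by (auto simp: le'_def)
  have "partial_order_on (f ` P) le'"
    unfolding partial_order_on_def preorder_on_def
  proof (intro conjI le'_sub)
    show "refl_on (f ` P) le'"
      using po(1) le'_iff by (auto simp: refl_on_def)
    show "trans le'"
    proof (rule transI)
      fix a b c assume "(a, b) \<in> le'" "(b, c) \<in> le'"
      moreover from this obtain p q r where "p \<in> P" "q \<in> P" "r \<in> P" "a = f p" "b = f q" "c = f r"
        using le'_sub by blast
      ultimately show "(a, c) \<in> le'"
        using po(2) by (auto simp: le'_iff dest: transD)
    qed
    show "antisym le'"
    proof (rule antisymI)
      fix a b assume "(a, b) \<in> le'" "(b, a) \<in> le'"
      moreover from this obtain p q where "p \<in> P" "q \<in> P" "a = f p" "b = f q"
        using le'_sub by blast
      ultimately show "a = b"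
        using po(3) by (auto simp: le'_iff dest: antisymD)
    qed
  qed
  moreover have "ccc (f ` P) le'"
    unfolding ccc_def
  proof (intro allI impI)
    fix A assume A: "antichain (f ` P) le' A"
    define B where "B = {p \<in> P. f p \<in> A}"
    have "compatible (f ` P) le' (f p) (f q)" if "p \<in> P" "q \<in> P" "compatible P le p q" for p q
      using that by (auto simp: compatible_def le'_iff)
    then have "antichain P le B"
      using A f_eq unfolding antichain_def B_def by blast
    then have "countable B"
      using P(3) by (auto simp: ccc_def)
    moreover have "A = f ` B"
      using A by (auto simp: antichain_def B_def)
    ultimately show "countable A"
      by blast
  qed
  moreover have "(`) f ` \<D> \<lesssim> omega1"
    using image_lepoll \<D>(1) lepoll_trans by blast
  moreover have "\<forall>D \<in> (`) f ` \<D>. dense_in (f ` P) le' D"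
  proof
    fix E assume "E \<in> (`) f ` \<D>"
    then obtain D where D: "D \<in> \<D>" "E = f ` D"
      by blast
    then have "dense_in P le D"
      using \<D>(2) by blast
    then have "D \<subseteq> P" and dense: "\<And>p. p \<in> P \<Longrightarrow> \<exists>d\<in>D. (d, p) \<in> le"
      by (auto simp: dense_in_def)
    show "dense_in (f ` P) le' E"
      unfolding dense_in_def D(2)
    proof (intro conjI ballI)
      show "f ` D \<subseteq> f ` P"
        using \<open>D \<subseteq> P\<close> by blast
      fix y assume "y \<in> f ` P"
      then obtain p where "p \<in> P" "y = f p"
        by blast
      moreover from this dense obtain d where "d \<in> D" "(d, p) \<in> le"
        by blast
      ultimately show "\<exists>e\<in>f ` D. (e, y) \<in> le'"
        using \<open>D \<subseteq> P\<close> le'_iff by blast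
    qed
  qed
  ultimately obtain H where H: "poset_filter (f ` P) le' H" "\<And>E. E \<in> (`) f ` \<D> \<Longrightarrow> H \<inter> E \<noteq> {}"
    using MA P(1) unfolding MA_omega1_def by (metis image_is_empty)
  define G where "G = {p \<in> P. f p \<in> H}"
  have HG: "H = f ` G"
    using H(1) by (auto simp: poset_filter_def G_def)
  show thesis
  proof
    show "poset_filter P le G"
      unfolding poset_filter_def
    proof (intro conjI ballI impI)
      show "G \<subseteq> P"
        by (auto simp: G_def)
      show "G \<noteq> {}"
        using H(1) HG by (auto simp: poset_filter_def)
      show "q \<in> G" if "p \<in> G" "q \<in> P" "(p, q) \<in> le" for p q
        using that H(1) by (auto simp: G_def poset_filter_def le'_iff)
      show "\<exists>r\<in>G. (r, p) \<in> le \<and> (r, q) \<in> le" if "p \<in> G" "q \<in> G" for p q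
      proof -
        have "\<exists>h\<in>H. (h, f p) \<in> le' \<and> (h, f q) \<in> le'"
          using that H(1) by (auto simp: G_def poset_filter_def)
        then obtain r where "r \<in> G" "(f r, f p) \<in> le'" "(f r, f q) \<in> le'"
          unfolding HG by blast
        moreover from this that have "r \<in> P" "p \<in> P" "q \<in> P"
          by (auto simp: G_def)
        ultimately show ?thesis
          using le'_iff by blast
      qed
    qed
    show "G \<inter> D \<noteq> {}" if "D \<in> \<D>" for D
    proof -
      have "D \<subseteq> P"
        using \<D>(2)[OF that] by (auto simp: dense_in_def)
      moreover have "H \<inter> f ` D \<noteq> {}"
        by (rule H(2)[OF imageI[OF that]])
      ultimately show ?thesis
        by (auto simp: G_def)
    qed
  qed
qed

section \<open>Finite approximations to a homogeneous partition\<close>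

text \<open>A condition is a finite piece of a relation assigning classes to points: \<open>(a, n) \<in> p\<close> puts
  \<open>a\<close> into the \<open>n\<close>-th class. A point may lie in several classes.\<close>

definition homogeneous_approx :: "'a set \<Rightarrow> ('a \<Rightarrow> 'a \<Rightarrow> 'c) \<Rightarrow> 'c \<Rightarrow> ('a \<times> nat) set set" where
  "homogeneous_approx X c k = {p. finite p \<and> p \<subseteq> X \<times> UNIV \<and>
     (\<forall>a b n. (a, n) \<in> p \<longrightarrow> (b, n) \<in> p \<longrightarrow> a \<noteq> b \<longrightarrow> c a b = k)}"

text \<open>Inclusion is reversed because the stronger condition, the one containing more
  information, has to come first in a pair.\<close>

definition extension_order :: "'a set set \<Rightarrow> 'a set rel" where
  "extension_order P = {(q, p). q \<in> P \<and> p \<in> P \<and> p \<subseteq> q}"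

lemma partial_order_on_extension_order: "partial_order_on P (extension_order P)"
  by (auto simp: partial_order_on_def preorder_on_def extension_order_def
      intro!: refl_onI transI antisymI)

text \<open>For infinite \<open>X\<close>, the finite subsets of \<open>X \<times> UNIV\<close> are
  no more numerous than the points of \<open>X\<close>. With \<open>X = omega1\<close> this makes
  the poset fit into the type for which Martin's axiom is assumed.\<close>

lemma homogeneous_approx_lepoll:
  assumes "infinite X"
  shows "homogeneous_approx X c k \<lesssim> X"
proof -
  have "homogeneous_approx X c k \<subseteq> Fpow (X \<times> UNIV)"
    by (auto simp: homogeneous_approx_def Fpow_def)
  then have "homogeneous_approx X c k \<lesssim> Fpow (X \<times> (UNIV :: nat set))"
    by (rule subset_imp_lepoll)
  also have "\<dots> \<approx> X \<times> (UNIV :: nat set)"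
    using assms by (intro eqpoll_Fpow) (auto simp: finite_cartesian_product_iff)
  also have "\<dots> \<lesssim> X \<times> X"
    using assms by (intro times_lepoll_mono) (auto simp: infinite_le_lepoll)
  also have "X \<times> X \<approx> X"
    using card_of_Times_same_infinite[OF assms] by (simp add: eqpoll_iff_card_of_ordIso)
  finally show ?thesis .
qed

text \<open>A finite condition leaves some class \<open>n\<close> empty. Placing \<open>a\<close>
  alone in that class puts no new pair of distinct points into a common class.\<close>

lemma dense_in_homogeneous_approx:
  assumes "a \<in> X" and P_def: "P = homogeneous_approx X c k"
  shows "dense_in P (extension_order P) {p \<in> P. \<exists>n. (a, n) \<in> p}"
  unfolding dense_in_def
proof (intro conjI ballI)
  fix p assume p: "p \<in> P"
  then have "finite (snd ` p)"
    by (simp add: P_def homogeneous_approx_def)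
  then obtain n where n: "n \<notin> snd ` p"
    using ex_new_if_finite infinite_UNIV_nat by blast
  then have "b = a" if "(b, n) \<in> insert (a, n) p" for b
    using that by force
  moreover have "(b, m) \<in> p" if "(b, m) \<in> insert (a, n) p" "m \<noteq> n" for b m
    using that by blast
  ultimately have "insert (a, n) p \<in> P"
    using p assms(1) unfolding P_def homogeneous_approx_def by (auto; blast)
  then show "\<exists>d\<in>{p \<in> P. \<exists>n. (a, n) \<in> p}. (d, p) \<in> extension_order P"
    using p by (intro bexI[of _ "insert (a, n) p"]) (auto simp: extension_order_def)
qed blast

text \<open>The tuples enumerate the petals of a \<Delta>-system inside an uncountable antichain. If
  two of them were alike with diagonal colour \<open>k\<close>, the union of their conditions would
  be a common extension. Entry \<open>0\<close> stands for the whole diagonal, on which alike tuples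
  have constant colour.\<close>

lemma not_ccc_tuples:
  fixes c :: "'a \<Rightarrow> 'a \<Rightarrow> 'c"
  assumes sym: "\<And>a b. a \<in> X \<Longrightarrow> b \<in> X \<Longrightarrow> c a a = c b b \<Longrightarrow> c a b = c b a"
    and P: "P = homogeneous_approx X c k"
    and nccc: "\<not> ccc P (extension_order P)"
  shows "\<exists>m (t :: nat set \<Rightarrow> 'a list). m > 0 \<and>
      (\<forall>\<alpha>\<in>omega1. length (t \<alpha>) = m \<and> set (t \<alpha>) \<subseteq> X) \<and>
      disjoint_family_on (\<lambda>\<alpha>. set (t \<alpha>)) omega1 \<and>
      (\<forall>\<alpha>\<in>omega1. \<forall>\<beta>\<in>omega1. \<alpha> \<noteq> \<beta> \<longrightarrow> alike c m (t \<alpha>) (t \<beta>) \<longrightarrow> c (t \<alpha> ! 0) (t \<beta> ! 0) \<noteq> k)"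
proof -
  from nccc obtain A where A: "antichain P (extension_order P) A" "uncountable A"
    by (auto simp: ccc_def)
  have AP: "A \<subseteq> P"
    using A(1) by (simp add: antichain_def)
  then have fin: "finite p" if "p \<in> A" for p
    using that by (auto simp: P homogeneous_approx_def)
  obtain B R m x where B: "B \<subseteq> A" "uncountable B" "m > 0"
    and x: "\<And>p. p \<in> B \<Longrightarrow> length (x p) = m \<and> distinct (x p) \<and> set (x p) = fst ` p - R"
    and dis: "disjoint_family_on (\<lambda>p. set (x p)) B"
    and root: "\<And>p q a n. p \<in> B \<Longrightarrow> q \<in> B \<Longrightarrow> a \<in> R \<Longrightarrow> (a, n) \<in> p \<longleftrightarrow> (a, n) \<in> q"
    and petal: "\<And>p q i n. p \<in> B \<Longrightarrow> q \<in> B \<Longrightarrow> i < m \<Longrightarrow> (x p ! i, n) \<in> p \<longleftrightarrow> (x q ! i, n) \<in> q"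
    by (rule delta_system_of_finite_relations[OF A(2)], erule fin, rule that, assumption+)
  have hom: "c a b = k" if "p \<in> B" "(a, n) \<in> p" "(b, n) \<in> p" "a \<noteq> b" for p a b n
    using that B(1) AP unfolding P homogeneous_approx_def by blast
  have inX: "a \<in> X" if "p \<in> B" "(a, n) \<in> p" for p a n
    using that B(1) AP unfolding P homogeneous_approx_def by blast
  have xX: "set (x p) \<subseteq> X" if "p \<in> B" for p
    using that x inX by fastforce
  have key: "c (x p ! 0) (x q ! 0) \<noteq> k" if pq: "p \<in> B" "q \<in> B" "p \<noteq> q" "alike c m (x p) (x q)" for p q
  proof
    assume k: "c (x p ! 0) (x q ! 0) = k"
    \<comment> \<open>The reversed pair needs \<open>sym\<close>, which applies because alikeness,
      taken with equal indices, gives corresponding points the same colour with themselves.\<close>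
    have diag: "c (x p ! i) (x q ! i) = k" "c (x q ! i) (x p ! i) = k" if "i < m" for i
    proof -
      show 1: "c (x p ! i) (x q ! i) = k"
        using pq(4) k that B(3) unfolding alike_def by metis
      have "c (x p ! i) (x p ! i) = c (x q ! i) (x q ! i)"
        using pq(4) that unfolding alike_def by blast
      moreover have "x p ! i \<in> X" "x q ! i \<in> X"
        using that x xX pq(1,2) by (metis nth_mem subsetD)+
      ultimately show "c (x q ! i) (x p ! i) = k"
        using 1 sym by metis
    qed
    \<comment> \<open>Only pairs with one point from each condition are in doubt. A root point lies
      in the same classes of both conditions, so such a pair already lies within one of them; petal
      points with equal index are handled by \<open>diag\<close>. Both orders are recorded because
      either point may come first.\<close>
    have cross: "c a b = k \<and> c b a = k" if ab: "(a, n) \<in> p" "(b, n) \<in> q" "a \<noteq> b" for a b n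
    proof (cases "a \<in> R \<or> b \<in> R")
      case True
      then have "(a, n) \<in> q \<and> (b, n) \<in> q \<or> (a, n) \<in> p \<and> (b, n) \<in> p"
        using ab root pq by blast
      then show ?thesis
        using hom ab(3) pq(1,2) by metis
    next
      case False
      then have "a \<in> set (x p)" "b \<in> set (x q)"
        using x pq ab by force+
      then obtain i j where ij: "i < m" "j < m" "a = x p ! i" "b = x q ! j"
        using x pq by (metis in_set_conv_nth)
      show ?thesis
      proof (cases "i = j")
        case True
        then show ?thesis
          using diag ij by blast
      next
        case False
        then have ne: "x p ! i \<noteq> x p ! j"
          using x[OF pq(1)] ij by (simp add: nth_eq_iff_index_eq)
        \<comment> \<open>Since the patterns agree, the \<open>j\<close>-th petal point of
          \<open>p\<close> shares class \<open>n\<close> with \<open>a\<close>, so that pair has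
          colour \<open>k\<close> inside \<open>p\<close>; alikeness transfers the colour to the
          mixed pair.\<close>
        have "(x p ! j, n) \<in> p"
          using petal[OF pq(1,2) ij(2)] ab ij by simp
        then have "c (x p ! i) (x p ! j) = k" "c (x p ! j) (x p ! i) = k"
          using hom pq(1) ab(1) ij(3) ne by metis+
        moreover have "c (x p ! i) (x p ! j) = c (x p ! i) (x q ! j)"
          "c (x p ! j) (x p ! i) = c (x p ! j) (x q ! i)"
          "c (x p ! j) (x q ! i) = c (x q ! j) (x p ! i)"
          using pq(4) ij ne unfolding alike_def by metis+
        ultimately show ?thesis
          using ij by simp
      qed
    qed
    have "c a b = k" if ab: "(a, n) \<in> p \<union> q" "(b, n) \<in> p \<union> q" "a \<noteq> b" for a b n
      using ab cross[of a n b] cross[of b n a] hom[OF pq(1), of a n b] hom[OF pq(2), of a n b] by blast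
    moreover have "finite p" "finite q" "p \<subseteq> X \<times> UNIV" "q \<subseteq> X \<times> UNIV"
      using pq B(1) AP by (auto simp: P homogeneous_approx_def)
    ultimately have "p \<union> q \<in> P"
      by (auto simp: P homogeneous_approx_def)
    moreover have "p \<in> P" "q \<in> P"
      using pq B(1) AP by auto
    ultimately have "compatible P (extension_order P) p q"
      by (auto simp: compatible_def extension_order_def intro!: bexI[of _ "p \<union> q"])
    then show False
      using A(1) B(1) pq(1-3) unfolding antichain_def by blast
  qed
  \<comment> \<open>Indexing by \<open>omega1\<close> gives the tuples of all colours a common index
    set, which is what allows their concatenation later.\<close>
  from B(2) obtain g where g: "inj_on g omega1" "g ` omega1 \<subseteq> B"
    by (auto simp: omega1_lepoll_iff[symmetric] lepoll_def)
  show ?thesis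
  proof (intro exI[of _ m] exI[of _ "x \<circ> g"] conjI ballI impI)
    show "disjoint_family_on (\<lambda>\<alpha>. set ((x \<circ> g) \<alpha>)) omega1"
      unfolding disjoint_family_on_def
    proof (intro ballI impI)
      fix \<alpha> \<beta> assume "\<alpha> \<in> omega1" "\<beta> \<in> omega1" "\<alpha> \<noteq> \<beta>"
      then have "g \<alpha> \<in> B" "g \<beta> \<in> B" "g \<alpha> \<noteq> g \<beta>"
        using g by (auto dest: inj_onD)
      then show "set ((x \<circ> g) \<alpha>) \<inter> set ((x \<circ> g) \<beta>) = {}"
        using disjoint_family_onD[OF dis] by simp
    qed
    show "c ((x \<circ> g) \<alpha> ! 0) ((x \<circ> g) \<beta> ! 0) \<noteq> k"
      if "\<alpha> \<in> omega1" "\<beta> \<in> omega1" "\<alpha> \<noteq> \<beta>" "alike c m ((x \<circ> g) \<alpha>) ((x \<circ> g) \<beta>)" for \<alpha> \<beta>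
      using that key[of "g \<alpha>" "g \<beta>"] g by (auto simp: inj_on_def)
    show "length ((x \<circ> g) \<alpha>) = m" "set ((x \<circ> g) \<alpha>) \<subseteq> X" if "\<alpha> \<in> omega1" for \<alpha>
    proof -
      have "g \<alpha> \<in> B"
        using g(2) that by blast
      then show "length ((x \<circ> g) \<alpha>) = m" "set ((x \<circ> g) \<alpha>) \<subseteq> X"
        using x xX by simp_all
    qed
  qed (rule B(3))
qed

section \<open>Rectangular colourings\<close>

text \<open>Every clause of \<open>alike\<close> concerns pairs of positions, so it restricts to a
  block after shifting indices by \<open>length u\<close>. This recovers the tuples of a single
  colour from a concatenation.\<close>

lemma alike_sublist:
  assumes al: "alike c (length (u @ v @ w)) (u @ v @ w) (u' @ v' @ w')"
    and len: "length u = length u'" "length v = length v'"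
  shows "alike c (length v) v v'"
proof -
  let ?x = "u @ v @ w" and ?y = "u' @ v' @ w'" and ?n = "length (u @ v @ w)"
  have nth: "?x ! (length u + i) = v ! i" "?y ! (length u + i) = v' ! i" "length u + i < ?n"
    if "i < length v" for i
    using that len by (simp_all add: nth_append)
  have dis: "set ?x \<inter> set ?y = {}"
    and diag: "\<And>i j. i < ?n \<Longrightarrow> j < ?n \<Longrightarrow>
      c (?x ! i) (?y ! i) = c (?x ! j) (?y ! j) \<and> c (?y ! i) (?x ! i) = c (?y ! j) (?x ! j)"
    and same: "\<And>i j. i < ?n \<Longrightarrow> j < ?n \<Longrightarrow> c (?x ! i) (?x ! j) = c (?y ! i) (?y ! j)"
    and cross: "\<And>i j. i < ?n \<Longrightarrow> j < ?n \<Longrightarrow> ?x ! i \<noteq> ?x ! j \<Longrightarrow>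
      c (?x ! i) (?x ! j) = c (?x ! i) (?y ! j) \<and> c (?x ! i) (?y ! j) = c (?y ! i) (?x ! j)"
    using al unfolding alike_def by blast+
  show ?thesis
    unfolding alike_def
  proof (intro conjI allI impI refl len(2)[symmetric])
    show "set v \<inter> set v' = {}"
      using dis by auto
  next
    fix i j assume ij: "i < length v" "j < length v"
    note nth' = nth[OF ij(1)] nth[OF ij(2)]
    show "c (v ! i) (v' ! i) = c (v ! j) (v' ! j)" "c (v' ! i) (v ! i) = c (v' ! j) (v ! j)"
      using diag[OF nth'(3,6)] unfolding nth' by blast+
    show "c (v ! i) (v ! j) = c (v' ! i) (v' ! j)"
      using same[OF nth'(3,6)] unfolding nth' .
    assume "v ! i \<noteq> v ! j"
    then show "c (v ! i) (v ! j) = c (v ! i) (v' ! j)" "c (v ! i) (v' ! j) = c (v' ! i) (v ! j)"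
      using cross[OF nth'(3,6)] unfolding nth' by blast+
  qed
qed

lemma rectangular_ccc:
  fixes c :: "nat set \<Rightarrow> nat set \<Rightarrow> 'c"
  assumes rect: "rectangular c"
    and sym: "\<And>a b. a \<in> omega1 \<Longrightarrow> b \<in> omega1 \<Longrightarrow> c a a = c b b \<Longrightarrow> c a b = c b a"
    and fin: "finite K" "\<And>a b. a \<in> omega1 \<Longrightarrow> b \<in> omega1 \<Longrightarrow> c a b \<in> K"
  shows "\<exists>k. ccc (homogeneous_approx omega1 c k) (extension_order (homogeneous_approx omega1 c k))"
proof (rule ccontr)
  assume "\<nexists>k. ccc (homogeneous_approx omega1 c k) (extension_order (homogeneous_approx omega1 c k))"
  then have "\<forall>k. \<exists>m (t :: nat set \<Rightarrow> nat set list). m > 0 \<and>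
      (\<forall>\<alpha>\<in>omega1. length (t \<alpha>) = m \<and> set (t \<alpha>) \<subseteq> omega1) \<and>
      disjoint_family_on (\<lambda>\<alpha>. set (t \<alpha>)) omega1 \<and>
      (\<forall>\<alpha>\<in>omega1. \<forall>\<beta>\<in>omega1. \<alpha> \<noteq> \<beta> \<longrightarrow> alike c m (t \<alpha>) (t \<beta>) \<longrightarrow> c (t \<alpha> ! 0) (t \<beta> ! 0) \<noteq> k)"
    using not_ccc_tuples[where X = omega1 and c = c] sym by blast
  then obtain m t where m: "\<And>k. m k > (0 :: nat)"
    and t: "\<And>k \<alpha>. \<alpha> \<in> omega1 \<Longrightarrow> length (t k \<alpha>) = m k \<and> set (t k \<alpha>) \<subseteq> omega1"
    and dis: "\<And>k. disjoint_family_on (\<lambda>\<alpha>. set (t k \<alpha>)) omega1"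
    and key: "\<And>k \<alpha> \<beta>. \<alpha> \<in> omega1 \<Longrightarrow> \<beta> \<in> omega1 \<Longrightarrow> \<alpha> \<noteq> \<beta> \<Longrightarrow>
      alike c (m k) (t k \<alpha>) (t k \<beta>) \<Longrightarrow> c (t k \<alpha> ! 0) (t k \<beta> ! 0) \<noteq> k"
    by metis
  \<comment> \<open>Tuples exist for every \<open>k\<close>, but listing the finitely many colours
    in \<open>K\<close> suffices, since the diagonal colour met below is the colour of a pair from
    \<open>omega1\<close>.\<close>
  obtain ks where ks: "set ks = K"
    using fin(1) finite_list by blast
  define h where "h ls \<alpha> = concat (map (\<lambda>k. t k \<alpha>) ls)" for ls \<alpha>
  have len_h: "length (h ls \<alpha>) = sum_list (map m ls)" if "\<alpha> \<in> omega1" for ls \<alpha>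
    using t[OF that] by (simp add: h_def length_concat comp_def)
  \<comment> \<open>Blocks of one colour are pairwise disjoint, but blocks of different colours may
    meet across indices. As a point lies in at most one block per colour, it lies in few
    concatenations, and a second thinning makes these disjoint.\<close>
  have "countable {\<alpha> \<in> omega1. a \<in> set (h ks \<alpha>)}" for a
  proof -
    have "countable {\<alpha> \<in> omega1. a \<in> set (t k \<alpha>)}" for k
    proof (cases "\<exists>\<alpha>\<in>omega1. a \<in> set (t k \<alpha>)")
      case True
      then obtain \<alpha> where "\<alpha> \<in> omega1" "a \<in> set (t k \<alpha>)"
        by blast
      then have "{\<alpha> \<in> omega1. a \<in> set (t k \<alpha>)} \<subseteq> {\<alpha>}"
        using dis[of k] by (auto simp: disjoint_family_on_def)
      then show ?thesis
        by (rule countable_subset) simp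
    next
      case False
      then have "{\<alpha> \<in> omega1. a \<in> set (t k \<alpha>)} = {}"
        by blast
      then show ?thesis
        by (metis countable_empty)
    qed
    then have "countable (\<Union>k \<in> set ks. {\<alpha> \<in> omega1. a \<in> set (t k \<alpha>)})"
      by (intro countable_UN) (auto intro: countable_finite)
    then show ?thesis
      by (rule countable_subset[rotated]) (auto simp: h_def)
  qed
  then obtain J where J: "J \<subseteq> omega1" "uncountable J" "disjoint_family_on (\<lambda>\<alpha>. set (h ks \<alpha>)) J"
    using uncountable_disjoint_subfamily[OF uncountable_omega1, of "\<lambda>\<alpha>. set (h ks \<alpha>)"]
    by (metis countable_finite List.finite_set)
  obtain J' where J': "J' \<subseteq> J" "J' \<approx> omega1"
    using uncountable_subset_eqpoll_omega1[OF J(2)] .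
  have "omega1 \<noteq> {}"
    using uncountable_omega1 by auto
  then have "K \<noteq> {}"
    using fin(2) by blast
  \<comment> \<open>Disjoint nonempty lists are distinct, so \<open>h ks\<close> is injective on
    \<open>J'\<close> and the family of concatenations has the size that rectangularity
    demands.\<close>
  have h_ne: "h ks \<alpha> \<noteq> []" if "\<alpha> \<in> omega1" for \<alpha>
  proof -
    obtain k where "k \<in> K"
      using \<open>K \<noteq> {}\<close> by blast
    moreover have "t k \<alpha> \<noteq> []"
      using t[OF that, of k] m[of k] by auto
    ultimately show ?thesis
      by (auto simp: h_def ks)
  qed
  have h_dis: "set (h ks \<alpha>) \<inter> set (h ks \<beta>) = {}" if "\<alpha> \<in> J'" "\<beta> \<in> J'" "\<alpha> \<noteq> \<beta>" for \<alpha> \<beta>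
    using that J(3) J'(1) by (auto simp: disjoint_family_on_def)
  have inj: "inj_on (h ks) J'"
    using h_dis h_ne J(1) J'(1) by (intro inj_onI) (metis inf.idem set_empty subsetD)
  have "\<forall>x\<in>h ks ` J'. length x = sum_list (map m ks) \<and> set x \<subseteq> omega1"
  proof (intro ballI conjI)
    fix x assume "x \<in> h ks ` J'"
    then obtain \<alpha> where "\<alpha> \<in> omega1" "x = h ks \<alpha>"
      using J(1) J'(1) by blast
    moreover have "set (h ks \<alpha>) \<subseteq> omega1"
      using t[OF \<open>\<alpha> \<in> omega1\<close>] by (auto simp: h_def subset_iff)
    ultimately show "length x = sum_list (map m ks)" "set x \<subseteq> omega1"
      using len_h by simp_all
  qed
  moreover have "h ks ` J' \<approx> omega1"
    using inj_on_image_eqpoll_self[OF inj] J'(2) eqpoll_trans by blast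
  moreover have "\<forall>x\<in>h ks ` J'. \<forall>y\<in>h ks ` J'. x \<noteq> y \<longrightarrow> set x \<inter> set y = {}"
    using h_dis by blast
  ultimately have "\<exists>x\<in>h ks ` J'. \<exists>y\<in>h ks ` J'. x \<noteq> y \<and> alike c (sum_list (map m ks)) x y"
    by (intro rect[unfolded rectangular_def, THEN spec, THEN spec, THEN mp] conjI)
  then obtain \<alpha> \<beta> where "\<alpha> \<in> J'" "\<beta> \<in> J'" "h ks \<alpha> \<noteq> h ks \<beta>"
    and al: "alike c (sum_list (map m ks)) (h ks \<alpha>) (h ks \<beta>)"
    by (elim bexE imageE conjE) simp
  then have ab: "\<alpha> \<in> omega1" "\<beta> \<in> omega1" "\<alpha> \<noteq> \<beta>"
    using J(1) J'(1) by auto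
  define d where "d = c (h ks \<alpha> ! 0) (h ks \<beta> ! 0)"
  have diag: "c (h ks \<alpha> ! i) (h ks \<beta> ! i) = d" if "i < length (h ks \<alpha>)" for i
    using al that len_h[OF ab(1)] unfolding alike_def d_def by (metis gr_zeroI not_less_zero)
  have "h ks \<alpha> ! 0 \<in> omega1" "h ks \<beta> ! 0 \<in> omega1"
  proof -
    have "h ks \<alpha> ! 0 \<in> set (h ks \<alpha>)" "h ks \<beta> ! 0 \<in> set (h ks \<beta>)"
      using h_ne ab by auto
    moreover have "set (h ks \<alpha>) \<subseteq> omega1" "set (h ks \<beta>) \<subseteq> omega1"
      using t[OF ab(1)] t[OF ab(2)] by (auto simp: h_def subset_iff)
    ultimately show "h ks \<alpha> ! 0 \<in> omega1" "h ks \<beta> ! 0 \<in> omega1"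
      by blast+
  qed
  then have "d \<in> set ks"
    using fin(2) ks by (simp add: d_def)
  \<comment> \<open>The block for \<open>d\<close> itself is isolated: it inherits alikeness and the
    diagonal colour \<open>d\<close>, which its choice excludes.\<close>
  then obtain ys zs where split: "ks = ys @ d # zs"
    by (metis split_list)
  have h_split: "h ks \<gamma> = h ys \<gamma> @ t d \<gamma> @ h zs \<gamma>" for \<gamma>
    by (simp add: h_def split)
  have len_eq: "length (h ys \<alpha>) = length (h ys \<beta>)" "length (t d \<alpha>) = length (t d \<beta>)"
    using len_h t ab by auto
  have "alike c (m d) (t d \<alpha>) (t d \<beta>)"
    using alike_sublist[OF _ len_eq] al h_split len_h[OF ab(1)] t[OF ab(1)] by metis
  moreover have "c (t d \<alpha> ! 0) (t d \<beta> ! 0) = d"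
    using diag[of "length (h ys \<alpha>)"] t[OF ab(1), of d] t[OF ab(2), of d] m[of d] len_eq
    by (simp add: h_split nth_append)
  ultimately show False
    using key ab by blast
qed

section \<open>Quantifier-free types\<close>

text \<open>By induction on formulas, a quantifier-free type is determined by its atomic
  formulas.\<close>

lemma qf_type_eqI:
  assumes "x = y \<longleftrightarrow> x' = y'"
    and "\<And>l u v. l \<in> L \<Longrightarrow> R l (var_val x y u) (var_val x y v) \<longleftrightarrow> R l (var_val x' y' u) (var_val x' y' v)"
  shows "qf_type L R x y = qf_type L R x' y'"
proof -
  have eq: "var_val x y u = var_val x y v \<longleftrightarrow> var_val x' y' u = var_val x' y' v" for u v
    using assms(1) by (cases u; cases v) auto
  have "qf_sat R x y \<phi> \<longleftrightarrow> qf_sat R x' y' \<phi>" if "symbols \<phi> \<subseteq> L" for \<phi>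
    using that by (induction \<phi>) (auto simp: eq assms(2))
  then show ?thesis
    by (auto simp: qf_type_def)
qed

lemma finite_range_qf_type:
  assumes "finite L"
  shows "finite (range (\<lambda>(x, y). qf_type L R x y))"
proof -
  \<comment> \<open>\<open>at\<close> collects the atomic data of a pair. It takes finitely many
    values because \<open>L\<close> and \<open>var\<close> are finite, and the type factors through
    it.\<close>
  define at where "at = (\<lambda>(x, y). (x = y, {(l, u, v). l \<in> L \<and> R l (var_val x y u) (var_val x y v)}))"
  have var: "finite (UNIV :: var set)"
    by (rule finite_subset[of _ "{VX, VY}"]) (auto intro: var.exhaust)
  have "range at \<subseteq> UNIV \<times> Pow (L \<times> UNIV \<times> UNIV)"
    by (auto simp: at_def)
  then have fin: "finite (range at)"
    by (rule finite_subset) (intro finite_SigmaI finite_Pow_iff[THEN iffD2] assms var finite_UNIV)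
  let ?c = "\<lambda>(x, y). qf_type L R x y"
  have eq: "?c z = ?c z'" if "at z = at z'" for z z'
  proof -
    obtain x y x' y' where z: "z = (x, y)" "z' = (x', y')"
      by fastforce
    have "qf_type L R x y = qf_type L R x' y'"
      using that by (intro qf_type_eqI) (auto simp: at_def z set_eq_iff)
    then show ?thesis
      by (simp add: z)
  qed
  \<comment> \<open>Each value of \<open>at\<close> is represented by one chosen pair, whose type is
    the type of all pairs with that value.\<close>
  have "range ?c \<subseteq> (\<lambda>a. ?c (inv_into UNIV at a)) ` range at"
  proof (rule image_subsetI)
    fix z
    have "?c z = ?c (inv_into UNIV at (at z))"
      by (rule eq) (simp add: f_inv_into_f)
    then show "?c z \<in> (\<lambda>a. ?c (inv_into UNIV at a)) ` range at"
      by blast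
  qed
  then show ?thesis
    using fin finite_surj by blast
qed

text \<open>Symmetry of the relations settles the atoms with two different variables. Atoms
  repeating one variable are exchanged by the swap, and equality of the types of
  \<open>(a, a)\<close> and \<open>(b, b)\<close> makes them agree.\<close>

lemma qf_type_commute:
  assumes "\<forall>l\<in>L. symp_on X (R l)" "a \<in> X" "b \<in> X" "qf_type L R a a = qf_type L R b b"
  shows "qf_type L R a b = qf_type L R b a"
proof (rule qf_type_eqI)
  fix l u v assume l: "l \<in> L"
  have "Rel l VX VX \<in> qf_type L R a a \<longleftrightarrow> Rel l VX VX \<in> qf_type L R b b"
    using assms(4) by simp
  then have "R l a a \<longleftrightarrow> R l b b"
    using l by (simp add: qf_type_def)
  moreover have "R l a b \<longleftrightarrow> R l b a"
    using assms(1-3) l by (auto dest: symp_onD)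
  ultimately show "R l (var_val a b u) (var_val a b v) \<longleftrightarrow> R l (var_val b a u) (var_val b a v)"
    by (cases u; cases v) auto
qed auto

theorem mainTheorem16:
  fixes L :: "'l set"
    and R :: "'l \<Rightarrow> nat set \<Rightarrow> nat set \<Rightarrow> bool"
  assumes "omega1 \<lesssim> (UNIV :: 'p set)"
    and "MA_omega1 TYPE('p)"
    and "finite L"
    and "\<forall>l\<in>L. symp_on omega1 (R l)"
    and "rectangular (qf_type L R)"
  shows "\<exists>A :: nat \<Rightarrow> nat set set.
           (\<forall>n. monochromatic (qf_type L R) (A n)) \<and> (\<Union>n. A n) = omega1"
proof -
  let ?c = "qf_type L R"
  have "?c a b \<in> range (\<lambda>(x, y). ?c x y)" for a b
    by (force intro: rangeI[of _ "(a, b)"])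
  then obtain k where ccc: "ccc (homogeneous_approx omega1 ?c k)
      (extension_order (homogeneous_approx omega1 ?c k))"
    using rectangular_ccc[OF assms(5) _ finite_range_qf_type[OF assms(3), of R]]
      qf_type_commute[OF assms(4)] by blast
  define P where "P = homogeneous_approx omega1 ?c k"
  \<comment> \<open>Meeting every \<open>D a\<close> forces each point of \<open>omega1\<close> into
    some class, so that the classes cover.\<close>
  define D where "D a = {p \<in> P. \<exists>n. (a, n) \<in> p}" for a
  have "P \<lesssim> omega1"
    unfolding P_def by (rule homogeneous_approx_lepoll[OF uncountable_infinite[OF uncountable_omega1]])
  then have "P \<lesssim> (UNIV :: 'p set)"
    using assms(1) lepoll_trans by blast
  moreover have "{} \<in> P"
    by (simp add: P_def homogeneous_approx_def)
  then have "P \<noteq> {}"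
    by blast
  moreover have "D ` omega1 \<lesssim> omega1"
    by (rule image_lepoll)
  moreover have "dense_in P (extension_order P) E" if "E \<in> D ` omega1" for E
    using that dense_in_homogeneous_approx[OF _ P_def] by (auto simp: D_def)
  ultimately obtain G where G: "poset_filter P (extension_order P) G"
    "\<And>E. E \<in> D ` omega1 \<Longrightarrow> G \<inter> E \<noteq> {}"
    using MA_omega1_lepoll[OF assms(2) _ _ partial_order_on_extension_order ccc[folded P_def]]
    by metis
  define A where "A n = {a. \<exists>p\<in>G. (a, n) \<in> p}" for n
  have GP: "G \<subseteq> P"
    using G(1) by (simp add: poset_filter_def)
  then have sub: "A n \<subseteq> omega1" for n
    by (auto simp: A_def P_def homogeneous_approx_def)
  \<comment> \<open>The two points may be placed by different conditions of \<open>G\<close>; a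
    common extension in the filter contains both pairs, and its homogeneity gives the
    colour.\<close>
  have "?c a b = k" if ab: "a \<in> A n" "b \<in> A n" "a \<noteq> b" for a b n
  proof -
    from ab obtain p q where "p \<in> G" "q \<in> G" "(a, n) \<in> p" "(b, n) \<in> q"
      by (auto simp: A_def)
    moreover have "\<forall>p\<in>G. \<forall>q\<in>G. \<exists>r\<in>G. (r, p) \<in> extension_order P \<and> (r, q) \<in> extension_order P"
      using G(1) by (simp add: poset_filter_def)
    moreover have "p \<subseteq> r" if "(r, p) \<in> extension_order P" for r p
      using that by (simp add: extension_order_def)
    ultimately obtain r where "r \<in> G" "p \<subseteq> r" "q \<subseteq> r"
      by metis
    then have "r \<in> P" "(a, n) \<in> r" "(b, n) \<in> r"
      using GP \<open>(a, n) \<in> p\<close> \<open>(b, n) \<in> q\<close> by auto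
    then show ?thesis
      using ab(3) unfolding P_def homogeneous_approx_def by blast
  qed
  then have "monochromatic ?c (A n)" for n
    using sub by (auto simp: monochromatic_def)
  moreover have "a \<in> (\<Union>n. A n)" if "a \<in> omega1" for a
    using G(2)[OF imageI[OF that]] by (auto simp: A_def D_def)
  ultimately show ?thesis
    using sub by blast
qed

end
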